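(* For an $N\times N$ matrix $V$ write $\|V\|_1=\sum_{i,j}|V_{ij}|$. Each of the following real orthogonal matrices $U$ fails to be a local maximizer of $\|\cdot\|_1$ on the unitary group $U(N)$. Equivalently, $\sqrt{N}\,U$ is not a complex almost Hadamard matrix. (1) $U=\frac{1}{N}(2J_N-NI_N)$, for every $N\geq3$ with $N\neq4$. Here $J_N$ is the all-ones matrix and $I_N$ is the identity matrix. (2) Let $q$ be a prime power and let $d\geq1$ be an integer. Consider the projective space $PG(d+1,\mathbb F_q)$. Its points are the $1$-dimensional subspaces of $\mathbb F_q^{d+2}$ and its hyperplanes are the $(d+1)$-dimensional subspaces, so $N=\frac{q^{d+2}-1}{q-1}$. Index the rows of $U$ by the points and the columns by the hyperplanes. Set $a=\frac{q^d-1}{q-1}$, $b=q^d$, $t=\frac{b-\sqrt b}{a}$, $x=-\frac{t}{\sqrt b(t+1)}$ and $y=\frac{1}{\sqrt b(t+1)}$. Define $U_{p,h}=x$ if the point $p$ lies in the hyperplane $h$, and $U_{p,h}=y$ otherwise. This is the matrix $I_N^{q,d}$. (3) The Paley biplane matrix. Take $N=11$ and index rows and columns by $\mathbb Z_{11}$. Set $a=2$, $b=3$, $t=\frac{3-\sqrt3}{2}$, $x=-\frac{t}{\sqrt3(t+1)}$ and $y=\frac{1}{\sqrt3(t+1)}$. Define $U_{ij}=x$ if $i-j\in\{1,3,4,5,9\}$ (mod $11$), and $U_{ij}=y$ otherwise.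
   Context: A matrix $H\in M_N(\mathbb C)$ is called complex almost Hadamard if $U=H/\sqrt N$ is unitary and $U$ is a local maximizer of $V\mapsto\sum_{i,j}|V_{ij}|$ on $U(N)$. In items (2) and (3), $U$ is obtained from the incidence structure of a symmetric block design by placing $x$ at incidences and $y$ at non-incidences. The matrices in (1)–(3) are real orthogonal matrices. *)

theory Defs
  imports "HOL-Analysis.Analysis"
begin

definition adjoint_matrix :: "complex^'n^'m \<Rightarrow> complex^'m^'n" where
  "adjoint_matrix V = map_matrix cnj (transpose V)"

definition unitary_group :: "(complex^'n^'n) set" where
  "unitary_group = {V. adjoint_matrix V ** V = mat 1 \<and> V ** adjoint_matrix V = mat 1}"

definition entrywise_norm1 :: "complex^'n^'m \<Rightarrow> real" where
  "entrywise_norm1 V = (\<Sum>i\<in>UNIV. \<Sum>j\<in>UNIV. norm (V $ i $ j))"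

definition local_maximizer_on :: "('a::topological_space \<Rightarrow> real) \<Rightarrow> 'a set \<Rightarrow> 'a \<Rightarrow> bool" where
  "local_maximizer_on f S u \<longleftrightarrow> u \<in> S \<and> (\<forall>\<^sub>F v in at u within S. f v \<le> f u)"

definition complex_almost_hadamard :: "complex^'n^'n \<Rightarrow> bool" where
  "complex_almost_hadamard H \<longleftrightarrow>
     local_maximizer_on entrywise_norm1 unitary_group ((1 / sqrt (real CARD('n))) *\<^sub>R H)"

definition all_ones_matrix :: "real^'n^'m" where
  "all_ones_matrix = (\<chi> i j. 1)"

text \<open>
  A symmetric block design is entered through its incidence relation \<open>R\<close>; the parameter
  \<open>a\<close> is the number of points common to two distinct blocks, and \<open>a + b\<close> the
  block size.
\<close>

definition two_valued_matrix :: "real \<Rightarrow> real \<Rightarrow> ('m \<Rightarrow> 'n \<Rightarrow> bool) \<Rightarrow> real^'n^'m" where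
  "two_valued_matrix x y R = (\<chi> i j. if R i j then x else y)"

definition design_t :: "real \<Rightarrow> real \<Rightarrow> real" where
  "design_t a b = (b - sqrt b) / a"

definition design_x :: "real \<Rightarrow> real \<Rightarrow> real" where
  "design_x a b = - design_t a b / (sqrt b * (design_t a b + 1))"

definition design_y :: "real \<Rightarrow> real \<Rightarrow> real" where
  "design_y a b = 1 / (sqrt b * (design_t a b + 1))"

definition design_matrix :: "real \<Rightarrow> real \<Rightarrow> ('m \<Rightarrow> 'n \<Rightarrow> bool) \<Rightarrow> real^'n^'m" where
  "design_matrix a b R = two_valued_matrix (design_x a b) (design_y a b) R"

text \<open>
  Points and hyperplanes of the projective space of the vector space \<open>'k^'m\<close>; a point
  \<open>p\<close> lies in a hyperplane \<open>h\<close> iff \<open>p \<subseteq> h\<close>.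
\<close>

definition proj_points :: "('k::field^'m) set set" where
  "proj_points = {p. vec.subspace p \<and> vec.dim p = 1}"

definition proj_hyperplanes :: "('k::field^'m) set set" where
  "proj_hyperplanes = {h. vec.subspace h \<and> vec.dim h = CARD('m) - 1}"

text \<open>
  The numeral type \<open>11\<close> is the ring of integers modulo 11, so the difference \<open>i - j\<close>
  is taken modulo 11.
\<close>

definition paley_biplane_incidence :: "11 \<Rightarrow> 11 \<Rightarrow> bool" where
  "paley_biplane_incidence i j \<longleftrightarrow> i - j \<in> {1, 3, 4, 5, 9}"

text \<open>
  Orthogonality of \<open>U\<close> is a separate conjunct because \<^const>\<open>local_maximizer_on\<close>
  requires membership in the unitary group: without it the other two could hold vacuously.
\<close>

definition orthogonal_non_maximizer :: "real^'n^'n \<Rightarrow> bool" where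
  "orthogonal_non_maximizer U \<longleftrightarrow>
     orthogonal_matrix U \<and>
     \<not> local_maximizer_on entrywise_norm1 unitary_group (map_matrix complex_of_real U) \<and>
     \<not> complex_almost_hadamard (sqrt (real CARD('n)) *\<^sub>R map_matrix complex_of_real U)"

end

theory Submission
  imports Defs
begin

text \<open>
  A real orthogonal matrix having two entries of different modulus in one row, say in columns
  \<open>j\<close> and \<open>k\<close>, is never a local maximizer over the unitary group. Multiply the component of
  every row along \<open>(e\<^sub>j - e\<^sub>k) / sqrt 2\<close> by a phase \<open>u\<close>: the two entries \<open>m + h\<close>, \<open>m - h\<close> of a row
  become \<open>m + u h\<close>, \<open>m - u h\<close>. The sum of the squares of their moduli is unchanged while the
  product of the moduli does not decrease, and increases strictly if \<open>m h \<noteq> 0\<close>; hence so does the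
  sum of the moduli. All three families are orthogonal matrices with exactly two values
  \<open>x\<close>, \<open>y\<close>, and it remains to check that \<open>\<bar>x\<bar> \<noteq> \<bar>y\<bar>\<close>.
\<close>

section \<open>Phase perturbation of two columns of an orthogonal matrix\<close>

lemma norm_add_norm_diff_phase:
  fixes m h :: real and u :: complex
  assumes u: "norm u = 1" "Im u \<noteq> 0"
  shows "\<bar>m + h\<bar> + \<bar>m - h\<bar> \<le> norm (of_real m + u * of_real h) + norm (of_real m - u * of_real h)"
    and "m * h \<noteq> 0 \<Longrightarrow>
         \<bar>m + h\<bar> + \<bar>m - h\<bar> < norm (of_real m + u * of_real h) + norm (of_real m - u * of_real h)"
proof -
  define p q where "p = norm (of_real m + u * of_real h)" and "q = norm (of_real m - u * of_real h)"
  have r1: "(Re u)\<^sup>2 + (Im u)\<^sup>2 = 1"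
    using u(1) by (simp add: cmod_def)
  have p: "p\<^sup>2 = m\<^sup>2 + h\<^sup>2 + 2 * m * h * Re u"
  proof -
    have "p\<^sup>2 = m\<^sup>2 + h\<^sup>2 * ((Re u)\<^sup>2 + (Im u)\<^sup>2) + 2 * m * h * Re u"
      unfolding p_def cmod_power2 by (simp add: power2_eq_square algebra_simps)
    then show ?thesis by (simp add: r1)
  qed
  have q: "q\<^sup>2 = m\<^sup>2 + h\<^sup>2 - 2 * m * h * Re u"
  proof -
    have "q\<^sup>2 = m\<^sup>2 + h\<^sup>2 * ((Re u)\<^sup>2 + (Im u)\<^sup>2) - 2 * m * h * Re u"
      unfolding q_def cmod_power2 by (simp add: power2_eq_square algebra_simps)
    then show ?thesis by (simp add: r1)
  qed
  have nn: "0 \<le> p" "0 \<le> q" by (auto simp: p_def q_def)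
  \<comment> \<open>The product is
    \<open>(m\<^sup>2 + h\<^sup>2)\<^sup>2 - (2 * m * h * Re u)\<^sup>2\<close>. Writing
    \<open>Re u\<close> through \<open>Im u\<close> isolates the gain over the value at
    \<open>u = 1\<close>, where the product of the moduli is
    \<open>\<bar>m\<^sup>2 - h\<^sup>2\<bar>\<close>.\<close>
  have "(p * q)\<^sup>2 = (m\<^sup>2 - h\<^sup>2)\<^sup>2 + 4 * (m * h)\<^sup>2 * (1 - (Re u)\<^sup>2)"
    unfolding power_mult_distrib p q by (simp add: power2_eq_square algebra_simps)
  also have "1 - (Re u)\<^sup>2 = (Im u)\<^sup>2" using r1 by simp
  finally have pq: "(p * q)\<^sup>2 = \<bar>m\<^sup>2 - h\<^sup>2\<bar>\<^sup>2 + 4 * (m * h)\<^sup>2 * (Im u)\<^sup>2" by simp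
  \<comment> \<open>The squares add up to the same amount before and after the rotation, so
    comparing the sums of moduli reduces to comparing their products.\<close>
  have sum: "(p + q)\<^sup>2 = 2 * (m\<^sup>2 + h\<^sup>2) + 2 * (p * q)"
    using p q by (simp add: power2_sum)
  have sum0: "(\<bar>m + h\<bar> + \<bar>m - h\<bar>)\<^sup>2 = 2 * (m\<^sup>2 + h\<^sup>2) + 2 * \<bar>m\<^sup>2 - h\<^sup>2\<bar>"
  proof -
    have "\<bar>m + h\<bar> * \<bar>m - h\<bar> = \<bar>m\<^sup>2 - h\<^sup>2\<bar>"
      by (simp add: abs_mult[symmetric] power2_eq_square algebra_simps)
    then show ?thesis
      by (simp add: power2_sum power2_diff algebra_simps)
  qed
  have le: "\<bar>m\<^sup>2 - h\<^sup>2\<bar> \<le> p * q"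
    by (rule power2_le_imp_le) (use pq nn in auto)
  have "(\<bar>m + h\<bar> + \<bar>m - h\<bar>)\<^sup>2 \<le> (p + q)\<^sup>2"
    unfolding sum sum0 using le by simp
  then have "\<bar>m + h\<bar> + \<bar>m - h\<bar> \<le> p + q"
    by (rule power2_le_imp_le) (simp add: nn)
  then show "\<bar>m + h\<bar> + \<bar>m - h\<bar> \<le> norm (of_real m + u * of_real h) + norm (of_real m - u * of_real h)"
    unfolding p_def q_def .
  assume "m * h \<noteq> 0"
  then have "0 < 4 * (m * h)\<^sup>2 * (Im u)\<^sup>2" using u(2) by simp
  with pq have "\<bar>m\<^sup>2 - h\<^sup>2\<bar>\<^sup>2 < (p * q)\<^sup>2" by linarith
  then have less: "\<bar>m\<^sup>2 - h\<^sup>2\<bar> < p * q"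
    using nn by (rule_tac power2_less_imp_less) auto
  have "(\<bar>m + h\<bar> + \<bar>m - h\<bar>)\<^sup>2 < (p + q)\<^sup>2"
    unfolding sum sum0 using less by simp
  then have "\<bar>m + h\<bar> + \<bar>m - h\<bar> < p + q"
    by (rule power2_less_imp_less) (simp add: nn)
  then show "\<bar>m + h\<bar> + \<bar>m - h\<bar> < norm (of_real m + u * of_real h) + norm (of_real m - u * of_real h)"
    unfolding p_def q_def .
qed

lemma orthogonal_matrix_column_products:
  fixes U :: "real^'n^'n"
  assumes "orthogonal_matrix U"
  shows "(\<Sum>i\<in>UNIV. U $ i $ j * U $ i $ k) = (if j = k then 1 else 0)"
proof -
  have "(transpose U ** U) $ j $ k = mat 1 $ j $ k"
    using assms by (simp add: orthogonal_matrix)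
  then show ?thesis
    by (simp add: matrix_matrix_mult_def transpose_def mat_def)
qed

text \<open>Orthonormal columns suffice: a left inverse of a square matrix is also a right
  inverse.\<close>

lemma unitary_groupI:
  fixes V :: "complex^'n^'n"
  assumes "\<And>j k. (\<Sum>i\<in>UNIV. cnj (V $ i $ j) * V $ i $ k) = (if j = k then 1 else 0)"
  shows "V \<in> unitary_group"
proof -
  have "adjoint_matrix V ** V = mat 1"
    using assms by (simp add: vec_eq_iff matrix_matrix_mult_def adjoint_matrix_def
        map_matrix_def transpose_def mat_def)
  then show ?thesis
    by (simp add: unitary_group_def matrix_left_right_inverse)
qed

text \<open>This is \<open>U\<close> times the matrix I + (u - 1) P, where P is the orthogonal
  projection onto the line of w = e_j - e_k. Since w has squared length 2, P = w w^T / 2, which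
  explains the factor \<open>(u - 1) / 2\<close>. At \<open>u = 1\<close> it gives back
  \<open>U\<close>.\<close>

definition phase_rotate :: "'n \<Rightarrow> 'n \<Rightarrow> complex \<Rightarrow> real^'n^'n \<Rightarrow> complex^'n^'n" where
  "phase_rotate j k u U = (\<chi> i l. of_real (U $ i $ l)
     + (u - 1) / 2 * of_real (U $ i $ j - U $ i $ k) * (of_bool (l = j) - of_bool (l = k)))"

text \<open>I + (u - 1) P has eigenvalues u and 1 on orthogonal subspaces, so it is unitary and so
  is its product with \<open>U\<close>. The calculation checks this on column products, with
  \<open>D\<close> the image of e_j - e_k under \<open>U\<close> and \<open>v\<close> the
  coordinates of e_j - e_k.\<close>

lemma phase_rotate_unitary:
  fixes U :: "real^'n^'n"
  assumes U: "orthogonal_matrix U" and jk: "j \<noteq> k" and u: "norm u = 1"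
  shows "phase_rotate j k u U \<in> unitary_group"
proof (rule unitary_groupI)
  fix l l' :: 'n
  define D where "D i = U $ i $ j - U $ i $ k" for i
  define v :: "'n \<Rightarrow> real" where "v l = of_bool (l = j) - of_bool (l = k)" for l
  define c where "c = (u - 1) / 2"
  have UU: "(\<Sum>i\<in>UNIV. U $ i $ l * U $ i $ l') = of_bool (l = l')" for l l'
    using orthogonal_matrix_column_products[OF U] by simp
  have DU: "(\<Sum>i\<in>UNIV. D i * U $ i $ l) = v l" for l
    unfolding D_def v_def by (simp add: left_diff_distrib sum_subtractf UU eq_commute)
  have DD: "(\<Sum>i\<in>UNIV. D i * D i) = 2"
  proof -
    have "(\<Sum>i\<in>UNIV. D i * D i) = v j - v k"
      unfolding DU[symmetric] by (simp add: D_def right_diff_distrib sum_subtractf)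
    then show ?thesis using jk by (simp add: v_def)
  qed
  \<comment> \<open>For a general u the left side equals (|u|^2 - 1) / 2. It is the coefficient of
    the rank-one correction to the identity in the matrix of column products.\<close>
  have c: "cnj c + c + 2 * (cnj c * c) = 0"
  proof -
    have "u * cnj u = 1" using u by (simp add: complex_norm_square[symmetric])
    then show ?thesis by (simp add: c_def field_simps)
  qed
  have "(\<Sum>i\<in>UNIV. cnj (phase_rotate j k u U $ i $ l) * phase_rotate j k u U $ i $ l')
     = (\<Sum>i\<in>UNIV. of_real (U $ i $ l * U $ i $ l') + c * of_real (v l') * of_real (D i * U $ i $ l)
          + cnj c * of_real (v l) * of_real (D i * U $ i $ l')
          + cnj c * c * of_real (v l * v l') * of_real (D i * D i))"
    by (rule sum.cong[OF refl])
      (simp add: phase_rotate_def c_def[symmetric] D_def[symmetric] v_def algebra_simps)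
  also have "\<dots> = of_bool (l = l') + c * of_real (v l') * of_real (v l)
          + cnj c * of_real (v l) * of_real (v l') + cnj c * c * of_real (v l * v l') * of_real 2"
    by (simp only: sum.distrib sum_distrib_left[symmetric] of_real_sum[symmetric] UU DU DD) simp
  also have "\<dots> = of_bool (l = l') + (cnj c + c + 2 * (cnj c * c)) * of_real (v l * v l')"
    by (simp add: algebra_simps)
  finally show "(\<Sum>i\<in>UNIV. cnj (phase_rotate j k u U $ i $ l) * phase_rotate j k u U $ i $ l')
     = (if l = l' then 1 else 0)"
    unfolding c by simp
qed

text \<open>Only the entries in columns \<open>j\<close> and \<open>k\<close> change, so the
  two-entry inequality decides the row. The strict case applies because 4 m h is the difference of
  the squares of these two entries.\<close>

lemma phase_rotate_row_norm:
  fixes U :: "real^'n^'n"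
  assumes jk: "j \<noteq> k" and u: "norm u = 1" "Im u \<noteq> 0"
  shows "(\<Sum>l\<in>UNIV. norm (map_matrix complex_of_real U $ i $ l))
           \<le> (\<Sum>l\<in>UNIV. norm (phase_rotate j k u U $ i $ l))"
    and "\<bar>U $ i $ j\<bar> \<noteq> \<bar>U $ i $ k\<bar> \<Longrightarrow>
         (\<Sum>l\<in>UNIV. norm (map_matrix complex_of_real U $ i $ l))
           < (\<Sum>l\<in>UNIV. norm (phase_rotate j k u U $ i $ l))"
proof -
  define m h where "m = (U $ i $ j + U $ i $ k) / 2" and "h = (U $ i $ j - U $ i $ k) / 2"
  have split: "(\<Sum>l\<in>UNIV. f l) = f j + f k + (\<Sum>l\<in>UNIV - {j, k}. f l)" for f :: "'n \<Rightarrow> real"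
    using jk by (subst sum.subset_diff[of "{j, k}"]) auto
  have L: "(\<Sum>l\<in>UNIV. norm (map_matrix complex_of_real U $ i $ l))
      = \<bar>m + h\<bar> + \<bar>m - h\<bar> + (\<Sum>l\<in>UNIV - {j, k}. \<bar>U $ i $ l\<bar>)"
    by (simp add: split map_matrix_def m_def h_def field_simps)
  have "phase_rotate j k u U $ i $ j = of_real m + u * of_real h"
    and "phase_rotate j k u U $ i $ k = of_real m - u * of_real h"
    using jk by (simp_all add: phase_rotate_def m_def h_def field_simps)
  then have R: "(\<Sum>l\<in>UNIV. norm (phase_rotate j k u U $ i $ l))
      = norm (of_real m + u * of_real h) + norm (of_real m - u * of_real h)
        + (\<Sum>l\<in>UNIV - {j, k}. \<bar>U $ i $ l\<bar>)"
    by (simp add: split) (simp add: phase_rotate_def)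
  show "(\<Sum>l\<in>UNIV. norm (map_matrix complex_of_real U $ i $ l))
           \<le> (\<Sum>l\<in>UNIV. norm (phase_rotate j k u U $ i $ l))"
    unfolding L R using norm_add_norm_diff_phase(1)[OF u, of m h] by simp
  assume "\<bar>U $ i $ j\<bar> \<noteq> \<bar>U $ i $ k\<bar>"
  then have "m * h \<noteq> 0" by (auto simp: m_def h_def)
  then show "(\<Sum>l\<in>UNIV. norm (map_matrix complex_of_real U $ i $ l))
           < (\<Sum>l\<in>UNIV. norm (phase_rotate j k u U $ i $ l))"
    unfolding L R using norm_add_norm_diff_phase(2)[OF u, of m h] by simp
qed

lemma phase_rotate_norm1_less:
  fixes U :: "real^'n^'n"
  assumes "j \<noteq> k" "norm u = 1" "Im u \<noteq> 0" "\<bar>U $ i $ j\<bar> \<noteq> \<bar>U $ i $ k\<bar>"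
  shows "entrywise_norm1 (map_matrix complex_of_real U) < entrywise_norm1 (phase_rotate j k u U)"
  unfolding entrywise_norm1_def
  by (intro sum_strict_mono_ex1 ballI bexI[of _ i] finite UNIV_I
      phase_rotate_row_norm[OF assms(1-3)] assms(4))

theorem orthogonal_non_maximizerI:
  fixes U :: "real^'n^'n"
  assumes U: "orthogonal_matrix U" and neq: "\<bar>U $ i $ j\<bar> \<noteq> \<bar>U $ i $ k\<bar>"
  shows "orthogonal_non_maximizer U"
proof -
  let ?U = "map_matrix complex_of_real U" and ?V = "\<lambda>\<theta>. phase_rotate j k (cis \<theta>) U"
  have jk: "j \<noteq> k" using neq by auto
  have less: "entrywise_norm1 ?U < entrywise_norm1 (?V \<theta>)" if "0 < \<theta>" "\<theta> < pi" for \<theta>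
    using phase_rotate_norm1_less[OF jk _ _ neq, of "cis \<theta>"] sin_gt_zero[OF that] by simp
  have "\<not> local_maximizer_on entrywise_norm1 unitary_group ?U"
  proof
    assume "local_maximizer_on entrywise_norm1 unitary_group ?U"
    then have ev: "\<forall>\<^sub>F v in at ?U within unitary_group. entrywise_norm1 v \<le> entrywise_norm1 ?U"
      by (simp add: local_maximizer_on_def)
    \<comment> \<open>On this interval the imaginary part of \<open>cis \<theta>\<close> is
      positive, as the strict inequality demands.\<close>
    have pos: "\<forall>\<^sub>F \<theta> in at_right 0. 0 < \<theta> \<and> \<theta> < pi"
      by (auto simp: eventually_at_right_field intro: exI[of _ pi])
    have "(?V \<longlongrightarrow> ?U) (at_right 0)"
    proof (intro vec_tendstoI)
      fix i l
      have "((\<lambda>\<theta>. ?V \<theta> $ i $ l) \<longlongrightarrow> of_real (U $ i $ l) + (cis 0 - 1) / 2 *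
          of_real (U $ i $ j - U $ i $ k) * (of_bool (l = j) - of_bool (l = k))) (at_right 0)"
        unfolding phase_rotate_def vec_lambda_beta by (intro tendsto_intros) auto
      then show "((\<lambda>\<theta>. ?V \<theta> $ i $ l) \<longlongrightarrow> ?U $ i $ l) (at_right 0)"
        by (simp add: map_matrix_def)
    qed
    \<comment> \<open>The filter \<open>at ?U within unitary_group\<close> omits \<open>?U\<close>
      itself, so the curve must avoid it; the strictly larger norm ensures this.\<close>
    moreover have "\<forall>\<^sub>F \<theta> in at_right 0. ?V \<theta> \<in> unitary_group \<and> ?V \<theta> \<noteq> ?U"
      using pos
    proof eventually_elim
      case (elim \<theta>)
      then show ?case
        using less[of \<theta>] phase_rotate_unitary[OF U jk, of "cis \<theta>"] by auto
    qed
    ultimately have "filterlim ?V (at ?U within unitary_group) (at_right 0)"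
      by (simp add: filterlim_at)
    \<comment> \<open>Along the curve the norm is both at most and strictly above its value at
      \<open>?U\<close>. A one-sided neighbourhood filter on the reals is nontrivial, so this cannot
      hold eventually.\<close>
    from eventually_compose_filterlim[OF ev this] pos
    have "\<forall>\<^sub>F \<theta> in at_right (0::real). False"
      by eventually_elim (use less in \<open>auto simp: not_le[symmetric]\<close>)
    then show False
      by simp
  qed
  then show ?thesis
    using U by (simp add: orthogonal_non_maximizer_def complex_almost_hadamard_def)
qed

section \<open>Orthogonality of two-valued matrices and of design matrices\<close>

lemma two_valued_orthogonal:
  fixes R :: "'n::finite \<Rightarrow> 'n \<Rightarrow> bool"
  assumes size: "\<And>j. real (card {i. R i j}) = r"
    and inter: "\<And>j k. j \<noteq> k \<Longrightarrow> real (card {i. R i j \<and> R i k}) = a"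
    and norm: "r * x\<^sup>2 + (real CARD('n) - r) * y\<^sup>2 = 1"
    and orth: "a * x\<^sup>2 + 2 * (r - a) * x * y + (real CARD('n) - 2 * r + a) * y\<^sup>2 = 0"
  shows "orthogonal_matrix (two_valued_matrix x y R)"
proof -
  have size': "(\<Sum>i\<in>UNIV. of_bool (R i j)) = r" for j
    using size[of j] by (simp add: sum_of_bool_eq)
  have inter': "(\<Sum>i\<in>UNIV. of_bool (R i j \<and> R i k)) = (if j = k then r else a)" for j k
    using inter[of j k] size'[of k] by (auto simp: sum_of_bool_eq)
  have "(\<Sum>i\<in>UNIV. (if R i j then x else y) * (if R i k then x else y)) = of_bool (j = k)" for j k
  proof -
    \<comment> \<open>Each entry is y plus (x - y) times the indicator of incidence, so a column
      product depends only on block sizes and on the size of the intersection.\<close>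
    have "(\<Sum>i\<in>UNIV. (if R i j then x else y) * (if R i k then x else y))
      = (\<Sum>i\<in>UNIV. y\<^sup>2 + (x - y) * y * (of_bool (R i j) + of_bool (R i k))
           + (x - y)\<^sup>2 * of_bool (R i j \<and> R i k))"
      by (rule sum.cong) (auto simp: power2_eq_square algebra_simps)
    also have "\<dots> = real CARD('n) * y\<^sup>2 + (x - y) * y * (2 * r)
        + (x - y)\<^sup>2 * (if j = k then r else a)"
      by (simp only: sum.distrib sum_distrib_left[symmetric] size' inter') simp
    also have "\<dots> = of_bool (j = k)"
      using norm orth by (auto simp: power2_eq_square algebra_simps)
    finally show ?thesis .
  qed
  then show ?thesis
    by (simp add: orthogonal_matrix vec_eq_iff matrix_matrix_mult_def transpose_def mat_def
        two_valued_matrix_def of_bool_def)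
qed

text \<open>Two distinct columns must differ in some row: otherwise their product would be both 0
  and 1. That row contains both \<open>x\<close> and \<open>y\<close>, which have different
  moduli.\<close>

lemma two_valued_non_maximizer:
  fixes R :: "'n::finite \<Rightarrow> 'n \<Rightarrow> bool"
  assumes U: "orthogonal_matrix (two_valued_matrix x y R)"
    and "2 \<le> CARD('n)" "\<bar>x\<bar> \<noteq> \<bar>y\<bar>"
  shows "orthogonal_non_maximizer (two_valued_matrix x y R)"
proof -
  let ?U = "two_valued_matrix x y R"
  obtain j k :: 'n where jk: "j \<noteq> k"
    using assms(2) card_2_iff' by (metis UNIV_I card_le_Suc0_iff_eq finite not_less_eq_eq numeral_2_eq_2)
  have "\<exists>i. R i j \<noteq> R i k"
  proof (rule ccontr)
    assume "\<not> ?thesis"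
    then have "?U $ i $ k = ?U $ i $ j" for i
      by (simp add: two_valued_matrix_def)
    then show False
      using orthogonal_matrix_column_products[OF U, of j k]
        orthogonal_matrix_column_products[OF U, of j j] jk by simp
  qed
  then obtain i where "R i j \<noteq> R i k" by blast
  then have "\<bar>?U $ i $ j\<bar> \<noteq> \<bar>?U $ i $ k\<bar>"
    using assms(3) by (auto simp: two_valued_matrix_def)
  then show ?thesis by (rule orthogonal_non_maximizerI[OF U])
qed

text \<open>The hypothesis \<open>param\<close> is the design identity lambda (N - 1) = k (k - 1)
  with lambda = a and k = a + b. The ratio of the moduli of the two values is t, and
  \<open>neq\<close> states that t is not 1.\<close>

lemma design_non_maximizer:
  fixes R :: "'n::finite \<Rightarrow> 'n \<Rightarrow> bool"
  assumes a: "0 < a" and b: "1 < b"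
    and size: "\<And>j. real (card {i. R i j}) = a + b"
    and inter: "\<And>j k. j \<noteq> k \<Longrightarrow> real (card {i. R i j \<and> R i k}) = a"
    and param: "a * (real CARD('n) - a - 2 * b) = b * (b - 1)"
    and neq: "b - sqrt b \<noteq> a"
  shows "orthogonal_non_maximizer (design_matrix a b R)"
proof -
  define s t where "s = sqrt b" and "t = design_t a b"
  define D where "D = s * (t + 1)"
  define N where "N = real CARD('n)"
  have s: "s\<^sup>2 = b" "1 < s" using b by (auto simp: s_def)
  have "s * 1 < s * s" using s(2) by (intro mult_strict_left_mono) auto
  then have "s < b" using s(1) by (simp add: power2_eq_square)
  have at: "a * t = b - s" using a by (simp add: t_def design_t_def s_def)
  have t: "0 < t" using a \<open>s < b\<close> by (simp add: t_def design_t_def s_def)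
  have D: "0 < D" "D\<^sup>2 = b * (t + 1)\<^sup>2"
    using s t by (auto simp: D_def power_mult_distrib)
  have x: "design_x a b = - t / D" and y: "design_y a b = 1 / D"
    by (simp_all add: design_x_def design_y_def t_def D_def s_def)
  \<comment> \<open>Up to a scalar, orthogonality of two columns is this quadratic in t. By
    \<open>param\<close> its roots are (b + sqrt b) / a and (b - sqrt b) / a;
    \<open>design_t\<close> is the smaller one.\<close>
  have "a * (a * t\<^sup>2 - 2 * b * t + (N - a - 2 * b))
      = (a * t)\<^sup>2 - 2 * b * (a * t) + a * (N - a - 2 * b)"
    by (simp add: power2_eq_square algebra_simps)
  also have "\<dots> = s\<^sup>2 - b"
    using param unfolding at N_def by (simp add: power2_eq_square algebra_simps)
  finally have key: "a * t\<^sup>2 - 2 * b * t + (N - a - 2 * b) = 0"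
    using a s by simp
  have "orthogonal_matrix (design_matrix a b R)"
    unfolding design_matrix_def
  proof (rule two_valued_orthogonal[OF size inter])
    have "(a + b) * (- t / D)\<^sup>2 + (N - (a + b)) * (1 / D)\<^sup>2
        = ((a + b) * t\<^sup>2 + (N - (a + b))) / D\<^sup>2"
      by (simp add: power_divide add_divide_distrib)
    \<comment> \<open>The two sides differ exactly by the quadratic in \<open>key\<close>, so one
      equation gives normalization as well as orthogonality.\<close>
    also have "(a + b) * t\<^sup>2 + (N - (a + b)) = D\<^sup>2"
      unfolding D(2) using key by (simp add: power2_eq_square algebra_simps)
    finally show "(a + b) * (design_x a b)\<^sup>2 + (real CARD('n) - (a + b)) * (design_y a b)\<^sup>2 = 1"
      unfolding x y N_def using D(1) by simp
    have "a * (- t / D)\<^sup>2 + 2 * (a + b - a) * (- t / D) * (1 / D) + (N - 2 * (a + b) + a) * (1 / D)\<^sup>2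
        = (a * t\<^sup>2 - 2 * b * t + (N - a - 2 * b)) / D\<^sup>2"
      using D(1) by (simp add: field_simps power2_eq_square)
    also have "\<dots> = 0" unfolding key by simp
    finally show "a * (design_x a b)\<^sup>2 + 2 * (a + b - a) * design_x a b * design_y a b
        + (real CARD('n) - 2 * (a + b) + a) * (design_y a b)\<^sup>2 = 0"
      unfolding x y N_def .
  qed
  moreover have "2 \<le> CARD('n)"
  proof -
    have "0 < a * (real CARD('n) - a - 2 * b)"
      unfolding param using b by simp
    then have "0 < real CARD('n) - a - 2 * b"
      using a by (simp add: zero_less_mult_iff)
    then show ?thesis using a b by linarith
  qed
  moreover have "\<bar>design_x a b\<bar> \<noteq> \<bar>design_y a b\<bar>"
    using D(1) t neq at by (auto simp: x y abs_divide s_def)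
  ultimately show ?thesis
    unfolding design_matrix_def by (rule two_valued_non_maximizer)
qed

lemma all_ones_non_maximizer:
  assumes "3 \<le> CARD('n::finite)" "CARD('n) \<noteq> 4"
  shows "orthogonal_non_maximizer
          ((1 / real CARD('n)) *\<^sub>R
             (2 *\<^sub>R all_ones_matrix - real CARD('n) *\<^sub>R mat 1) :: real^'n^'n)"
proof -
  define N where "N = real CARD('n)"
  have N: "3 \<le> N" "N \<noteq> 4"
    using assms by (auto simp: N_def)
  have "((1 / N) *\<^sub>R (2 *\<^sub>R all_ones_matrix - N *\<^sub>R mat 1) :: real^'n^'n)
      = two_valued_matrix (2 / N - 1) (2 / N) (=)"
    using N by (auto simp: vec_eq_iff all_ones_matrix_def mat_def two_valued_matrix_def field_simps)
  moreover have "orthogonal_matrix (two_valued_matrix (2 / N - 1) (2 / N) (=) :: real^'n^'n)"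
  \<comment> \<open>The blocks are single points, so distinct blocks are disjoint;
    \<open>design_non_maximizer\<close>, which assumes a > 0, does not cover this case.\<close>
  proof (rule two_valued_orthogonal[where r = 1 and a = 0])
    show "1 * (2 / N - 1)\<^sup>2 + (real CARD('n) - 1) * (2 / N)\<^sup>2 = 1"
      using N unfolding N_def[symmetric] by (simp add: field_simps power2_eq_square)
    show "0 * (2 / N - 1)\<^sup>2 + 2 * (1 - 0) * (2 / N - 1) * (2 / N)
        + (real CARD('n) - 2 * 1 + 0) * (2 / N)\<^sup>2 = 0"
      using N unfolding N_def[symmetric] by (simp add: field_simps power2_eq_square)
  next
    fix j k :: 'n assume "j \<noteq> k"
    then have "{i. i = j \<and> i = k} = {}" by auto
    then show "real (card {i. i = j \<and> i = k}) = 0" by simp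
  qed simp
  moreover have "\<bar>2 / N - 1\<bar> \<noteq> \<bar>2 / N\<bar>"
  proof -
    \<comment> \<open>For N at least 3 the moduli are 1 - 2/N and 2/N, which agree only at N =
      4.\<close>
    have "2 / N < 1" "2 / N \<noteq> 1 / 2" "0 < 2 / N" using N by (auto simp: field_simps)
    then show ?thesis by linarith
  qed
  ultimately show ?thesis
    using two_valued_non_maximizer assms unfolding N_def by fastforce
qed

section \<open>Counting points and intersecting hyperplanes over a finite field\<close>

lemma card_span_independent:
  fixes B :: "('k::{field,finite}^'m) set"
  assumes "finite B" "vec.independent B"
  shows "card (vec.span B) = CARD('k) ^ card B"
  using assms
proof (induction B rule: finite_induct)
  case empty
  then show ?case by simp
next
  case (insert v B)
  have ind: "vec.independent B" and v: "v \<notin> vec.span B"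
    using insert by (auto simp: vec.independent_insert)
  let ?f = "\<lambda>(c, w). c *s v + w"
  \<comment> \<open>Adjoining \<open>v\<close> multiplies the size of the span by the size of the
    field: \<open>c\<close> and \<open>w\<close> are unique because \<open>v\<close> lies outside
    the span of \<open>B\<close>.\<close>
  have inj: "inj_on ?f (UNIV \<times> vec.span B)"
  proof (rule inj_onI, clarify)
    fix c c' :: 'k and w w'
    assume w: "w \<in> vec.span B" "w' \<in> vec.span B" and eq: "c *s v + w = c' *s v + w'"
    have d: "(c - c') *s v = w' - w"
      using eq by (simp add: vec.scale_left_diff_distrib algebra_simps)
    have "c = c'"
    proof (rule ccontr)
      assume "c \<noteq> c'"
      then have "v = inverse (c - c') *s ((c - c') *s v)"
        by (metis left_inverse right_minus_eq vec.scale_one vec.scale_scale)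
      also have "\<dots> \<in> vec.span B"
        unfolding d using w by (intro vec.span_scale vec.span_diff)
      finally show False using v by simp
    qed
    then show "c = c' \<and> w = w'" using eq by simp
  qed
  have img: "vec.span (insert v B) = ?f ` (UNIV \<times> vec.span B)"
  proof (intro equalityI subsetI)
    fix u assume "u \<in> vec.span (insert v B)"
    then obtain c where "u - c *s v \<in> vec.span B"
      by (auto simp: vec.span_insert)
    then show "u \<in> ?f ` (UNIV \<times> vec.span B)"
      by (intro image_eqI[of _ _ "(c, u - c *s v)"]) auto
  next
    fix u assume "u \<in> ?f ` (UNIV \<times> vec.span B)"
    then obtain c w where "u = c *s v + w" "w \<in> vec.span B" by auto
    then have "u - c *s v \<in> vec.span B" by simp
    then show "u \<in> vec.span (insert v B)" by (auto simp: vec.span_insert)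
  qed
  show ?case
    unfolding img using insert ind by (simp add: card_image[OF inj] card_cartesian_product)
qed

lemma card_subspace:
  fixes W :: "('k::{field,finite}^'m) set"
  assumes "vec.subspace W"
  shows "card W = CARD('k) ^ vec.dim W"
proof -
  obtain B where "B \<subseteq> W" "vec.independent B" "W \<subseteq> vec.span B" "card B = vec.dim W"
    using vec.basis_exists by blast
  moreover from this assms have "vec.span B = W"
    by (simp add: subset_antisym vec.span_minimal)
  ultimately show ?thesis
    using card_span_independent[of B] vec.finiteI_independent by metis
qed

lemma card_field_ge_2: "2 \<le> CARD('k::{field,finite})"
proof -
  have "card {0, 1 :: 'k} \<le> CARD('k)" by (rule card_mono) auto
  then show ?thesis by simp
qed

lemma proj_point_eq_span:
  fixes p :: "('k::{field,finite}^'m) set"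
  assumes "p \<in> proj_points" "v \<in> p" "v \<noteq> 0"
  shows "p = vec.span {v}"
proof -
  have "vec.span {v} \<subseteq> p"
    using assms by (intro vec.span_minimal) (auto simp: proj_points_def)
  moreover have "vec.dim p \<le> vec.dim (vec.span {v})"
    using assms by (simp add: proj_points_def)
  ultimately show ?thesis
    using assms vec.subspace_dim_equal[of "vec.span {v}" p] by (auto simp: proj_points_def)
qed

text \<open>The points inside \<open>W\<close> partition its nonzero vectors into classes of size q
  - 1, where q is the size of the field.\<close>

lemma card_proj_points_subset:
  fixes W :: "('k::{field,finite}^'m) set"
  assumes W: "vec.subspace W"
  shows "real (card {p \<in> proj_points. p \<subseteq> W})
           = (real CARD('k) ^ vec.dim W - 1) / (real CARD('k) - 1)"
proof -
  let ?P = "{p \<in> proj_points. p \<subseteq> W}" and ?q = "CARD('k)"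
  have q: "2 \<le> ?q" by (rule card_field_ge_2)
  have "W - {0} = (\<Union>p\<in>?P. p - {0})"
  proof (intro equalityI subsetI)
    fix v assume v: "v \<in> W - {0}"
    then have "vec.span {v} \<in> ?P"
      using W by (auto simp: proj_points_def intro: vec.span_minimal[THEN subsetD])
    moreover have "v \<in> vec.span {v}" by (simp add: vec.span_base)
    ultimately show "v \<in> (\<Union>p\<in>?P. p - {0})" using v by blast
  qed auto
  moreover have "card (\<Union>p\<in>?P. p - {0}) = (\<Sum>p\<in>?P. card (p - {0}))"
    \<comment> \<open>Disjointness holds because a nonzero vector spans any point containing
      it.\<close>
    by (rule card_UN_disjoint) (use proj_point_eq_span in \<open>auto, blast+\<close>)
  moreover have "card (p - {0}) = ?q - 1" if "p \<in> ?P" for p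
    using that card_subspace[of p]
    by (auto simp: proj_points_def vec.subspace_0 card_Diff_singleton)
  ultimately have "card (W - {0}) = card ?P * (?q - 1)"
    by simp
  moreover have "card (W - {0}) = ?q ^ vec.dim W - 1"
    using card_subspace[OF W] W by (simp add: vec.subspace_0 card_Diff_singleton)
  ultimately have "?q ^ vec.dim W - 1 = card ?P * (?q - 1)"
    by simp
  then have "real (?q ^ vec.dim W - 1) = real (card ?P) * real (?q - 1)"
    by (simp only: of_nat_mult[symmetric])
  then show ?thesis
    using q by (simp add: of_nat_diff field_simps)
qed

text \<open>The sum of two distinct hyperplanes is the whole space: were its dimension smaller, both
  would equal it. The dimension formula then gives the intersection.\<close>

lemma dim_Int_hyperplanes:
  fixes h h' :: "('k::field^'m) set"
  assumes "h \<in> proj_hyperplanes" "h' \<in> proj_hyperplanes" "h \<noteq> h'"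
  shows "vec.dim (h \<inter> h') = CARD('m) - 2"
proof -
  have h: "vec.subspace h" "vec.dim h = CARD('m) - 1"
    and h': "vec.subspace h'" "vec.dim h' = CARD('m) - 1"
    using assms by (auto simp: proj_hyperplanes_def)
  let ?S = "{x + y |x y. x \<in> h \<and> y \<in> h'}"
  have S: "vec.subspace ?S" by (rule vec.subspace_sums) fact+
  have sub: "h \<subseteq> ?S" "h' \<subseteq> ?S"
    using vec.subspace_0[OF h(1)] vec.subspace_0[OF h'(1)] by force+
  have "\<not> vec.dim ?S \<le> CARD('m) - 1"
  proof
    assume "vec.dim ?S \<le> CARD('m) - 1"
    then have "h = ?S"
      using h by (intro vec.subspace_dim_equal S sub) simp_all
    also from \<open>vec.dim ?S \<le> CARD('m) - 1\<close> have "?S = h'"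
      using h' by (intro vec.subspace_dim_equal[symmetric] S sub) simp_all
    finally show False using assms(3) by contradiction
  qed
  moreover have "vec.dim ?S \<le> CARD('m)"
    by (rule dim_subset_UNIV_cart_gen)
  ultimately have "vec.dim ?S = CARD('m)" by linarith
  then show ?thesis
    using vec.dim_sums_Int[OF h(1) h'(1)] h(2) h'(2) by simp
qed

text \<open>The bijections \<open>pt\<close> and \<open>hyp\<close> label points and hyperplanes by
  one index type, which makes the incidence matrix square. A hyperplane has a + b points, and two
  distinct ones share the a points of a subspace of dimension d.\<close>

lemma projective_non_maximizer:
  fixes pt hyp :: "'i::finite \<Rightarrow> ('k::{field,finite}^'m::finite) set"
  assumes q: "q = CARD('k)" and d: "1 \<le> d" and m: "CARD('m) = d + 2"
    and pt: "bij_betw pt UNIV proj_points" and hyp: "bij_betw hyp UNIV proj_hyperplanes"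
  shows "real CARD('i) = (real q ^ (d + 2) - 1) / (real q - 1)"
    and "orthogonal_non_maximizer
            (design_matrix ((real q ^ d - 1) / (real q - 1)) (real q ^ d) (\<lambda>i j. pt i \<subseteq> hyp j))"
proof -
  have q2: "2 \<le> q" using card_field_ge_2[where 'k = 'k] q by simp
  have count: "real (card {i. pt i \<subseteq> W}) = (real q ^ vec.dim W - 1) / (real q - 1)"
    if "vec.subspace W" for W
  proof -
    have "pt ` {i. pt i \<subseteq> W} = {p \<in> range pt. p \<subseteq> W}"
      by auto
    then have "pt ` {i. pt i \<subseteq> W} = {p \<in> proj_points. p \<subseteq> W}"
      using pt by (simp add: bij_betw_def)
    moreover have "inj_on pt {i. pt i \<subseteq> W}"
      using bij_betw_imp_inj_on[OF pt] by (rule inj_on_subset) simp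
    ultimately show ?thesis
      using card_proj_points_subset[OF that] card_image[of pt "{i. pt i \<subseteq> W}"] q by simp
  qed
  show card: "real CARD('i) = (real q ^ (d + 2) - 1) / (real q - 1)"
    using count[of UNIV] m by (simp add: vec.dim_UNIV card_cart_basis)
  have H: "hyp j \<in> proj_hyperplanes" for j
    using hyp by (auto simp: bij_betw_def)
  define a b where "a = (real q ^ d - 1) / (real q - 1)" and "b = real q ^ d"
  have q1: "0 < real q - 1" using q2 by simp
  have b: "1 < b" unfolding b_def using q2 d by (intro one_less_power) auto
  have aq: "a * (real q - 1) = b - 1" using q1 by (simp add: a_def b_def)
  have a: "0 < a" using b q1 by (simp add: a_def b_def)
  have "orthogonal_non_maximizer (design_matrix a b (\<lambda>i j. pt i \<subseteq> hyp j))"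
  proof (rule design_non_maximizer[OF a b])
    fix j
    have "real (card {i. pt i \<subseteq> hyp j}) = (real q ^ (d + 1) - 1) / (real q - 1)"
      using count[of "hyp j"] H[of j] m by (simp add: proj_hyperplanes_def)
    also have "\<dots> = a + b"
      using q1 by (simp add: a_def b_def field_simps)
    finally show "real (card {i. pt i \<subseteq> hyp j}) = a + b" .
  next
    fix j k :: 'i assume "j \<noteq> k"
    then have "hyp j \<noteq> hyp k" using hyp by (auto simp: bij_betw_def inj_on_def)
    then have "vec.dim (hyp j \<inter> hyp k) = d"
      using dim_Int_hyperplanes[OF H H] m by simp
    moreover have "vec.subspace (hyp j \<inter> hyp k)"
      using H[of j] H[of k] by (auto simp: proj_hyperplanes_def intro: vec.subspace_inter)
    ultimately show "real (card {i. pt i \<subseteq> hyp j \<and> pt i \<subseteq> hyp k}) = a"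
      using count[of "hyp j \<inter> hyp k"] by (simp add: a_def)
  next
    have "real CARD('i) * (real q - 1) = (real q)\<^sup>2 * b - 1"
      using q1 by (simp add: card b_def power_add power2_eq_square)
    \<comment> \<open>Here (q^2 b - 1) - (b - 1) - 2 b (q - 1) = b (q - 1)^2.\<close>
    then have "(real CARD('i) - a - 2 * b) * (real q - 1) = (b * (real q - 1)) * (real q - 1)"
      using aq by (simp add: algebra_simps power2_eq_square)
    then have "real CARD('i) - a - 2 * b = b * (real q - 1)"
      using q1 by simp
    then show "a * (real CARD('i) - a - 2 * b) = b * (b - 1)"
      using aq by simp
  next
    \<comment> \<open>Equality would give a = s (s - 1) with s = sqrt b. Comparing with a (q - 1) =
      (s - 1) (s + 1) yields s (q - 2) = 1, impossible for q = 2, and for q at least 3 because s >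
      1.\<close>
    show "b - sqrt b \<noteq> a"
    proof
      define s where "s = sqrt b"
      have s: "s * s = b" "1 < s" using b by (auto simp: s_def)
      assume "b - sqrt b = a"
      then have "a = (s - 1) * s"
        using s(1) by (simp add: s_def[symmetric] algebra_simps)
      moreover have "b - 1 = (s - 1) * (s + 1)"
        using s(1) by (simp add: algebra_simps)
      ultimately have "(s - 1) * (s * (real q - 1)) = (s - 1) * (s + 1)"
        using aq by (simp only: mult.assoc)
      then have "s * (real q - 1) = s + 1"
        using s(2) by simp
      then have eq: "s * (real q - 2) = 1"
        by (simp add: algebra_simps)
      show False
      proof (cases "q = 2")
        case True
        then show ?thesis using eq by simp
      next
        case False
        then have "1 \<le> real q - 2" using q2 by linarith
        then have "s * 1 \<le> s * (real q - 2)" using s(2) by (intro mult_left_mono) auto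
        then show ?thesis using eq s(2) by simp
      qed
    qed
  qed
  then show "orthogonal_non_maximizer
      (design_matrix ((real q ^ d - 1) / (real q - 1)) (real q ^ d) (\<lambda>i j. pt i \<subseteq> hyp j))"
    unfolding a_def b_def .
qed

section \<open>The Paley biplane\<close>

lemma UNIV_mod_11: "(UNIV :: 11 set) = {0, 1, 2, 3, 4, 5, 6, 7, 8, 9, 10}"
proof -
  have "x \<in> {0, 1, 2, 3, 4, 5, 6, 7, 8, 9, 10}" for x :: 11
  \<comment> \<open>As 11 is odd, its numeral type is built with \<open>bit1\<close>; the case rule
    supplies an integer representative from 0 to 10.\<close>
  proof (cases x rule: bit1_cases)
    case (of_int z)
    then have "z \<in> {0, 1, 2, 3, 4, 5, 6, 7, 8, 9, 10}" by (simp, arith)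
    then show ?thesis using of_int(1) by auto
  qed
  then show ?thesis by blast
qed

text \<open>The nonzero squares modulo 11 form an (11, 5, 2) difference set; the ten nonzero shifts
  are checked one by one.\<close>

lemma paley_difference_set:
  fixes e :: 11
  assumes "e \<noteq> 0"
  shows "card {i \<in> {1, 3, 4, 5, 9}. i + e \<in> {1, 3, 4, 5, 9}} = 2"
proof -
  have "e \<in> {1, 2, 3, 4, 5, 6, 7, 8, 9, 10}"
    using assms UNIV_mod_11 by auto
  then show ?thesis
    by (elim insertE emptyE) (simp_all add: Collect_conv_if conj_disj_distribR Collect_disj_eq)
qed

lemma paley_biplane_non_maximizer:
  "orthogonal_non_maximizer (design_matrix 2 3 paley_biplane_incidence)"
proof (rule design_non_maximizer)
  fix j :: 11
  have "{i. paley_biplane_incidence i j} = (\<lambda>i. i + j) ` {1, 3, 4, 5, 9}"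
  proof (intro equalityI subsetI)
    fix i assume "i \<in> {i. paley_biplane_incidence i j}"
    then show "i \<in> (\<lambda>i. i + j) ` {1, 3, 4, 5, 9}"
      unfolding paley_biplane_incidence_def by (intro image_eqI[of _ _ "i - j"]) simp_all
  qed (auto simp: paley_biplane_incidence_def)
  then show "real (card {i. paley_biplane_incidence i j}) = 2 + 3"
    by (simp add: card_image del: image_insert)
next
  fix j k :: 11 assume "j \<noteq> k"
  let ?D = "{i \<in> {1, 3, 4, 5, 9}. i + (j - k) \<in> {1, 3, 4, 5, 9}}"
  \<comment> \<open>Translation by \<open>j\<close> turns the common rows of two columns into the
    difference-set count for the shift \<open>j - k\<close>, since i - k = (i - j) + (j -
    k).\<close>
  have "{i. paley_biplane_incidence i j \<and> paley_biplane_incidence i k} = (\<lambda>i. i + j) ` ?D"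
  proof (intro equalityI subsetI)
    fix i assume "i \<in> {i. paley_biplane_incidence i j \<and> paley_biplane_incidence i k}"
    then show "i \<in> (\<lambda>i. i + j) ` ?D"
      unfolding paley_biplane_incidence_def by (intro image_eqI[of _ _ "i - j"]) simp_all
  next
    fix i assume "i \<in> (\<lambda>i. i + j) ` ?D"
    then obtain l where "l \<in> ?D" "i = l + j" by blast
    then show "i \<in> {i. paley_biplane_incidence i j \<and> paley_biplane_incidence i k}"
      unfolding paley_biplane_incidence_def mem_Collect_eq
      by (simp only: add_diff_cancel_right' add_diff_eq[symmetric])
  qed
  moreover have "card ?D = 2"
    using \<open>j \<noteq> k\<close> by (intro paley_difference_set) simp
  ultimately show "real (card {i. paley_biplane_incidence i j \<and> paley_biplane_incidence i k}) = 2"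
    by (simp add: card_image)
next
  show "3 - sqrt 3 \<noteq> (2 :: real)"
  proof
    assume "3 - sqrt 3 = (2 :: real)"
    then have "sqrt 3 = sqrt 1" by simp
    then show False by (simp only: real_sqrt_eq_iff)
  qed
qed simp_all

theorem theorem6p5:
  shows
    "(3 \<le> CARD('n::finite) \<and> CARD('n) \<noteq> 4 \<longrightarrow>
        orthogonal_non_maximizer
          ((1 / real CARD('n)) *\<^sub>R
             (2 *\<^sub>R all_ones_matrix - real CARD('n) *\<^sub>R mat 1) :: real^'n^'n))
     \<and>
     (\<forall>(q::nat) (d::nat)
        (pt :: 'i::finite \<Rightarrow> ('k::{field,finite}^'m::finite) set)
        (hyp :: 'i \<Rightarrow> ('k^'m) set).
        q = CARD('k) \<and> 1 \<le> d \<and> CARD('m) = d + 2 \<and>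
        bij_betw pt UNIV proj_points \<and> bij_betw hyp UNIV proj_hyperplanes \<longrightarrow>
          real CARD('i) = (real q ^ (d + 2) - 1) / (real q - 1) \<and>
          orthogonal_non_maximizer
            (design_matrix ((real q ^ d - 1) / (real q - 1)) (real q ^ d)
               (\<lambda>i j. pt i \<subseteq> hyp j)))
     \<and>
     orthogonal_non_maximizer (design_matrix 2 3 paley_biplane_incidence)"
  by (intro conjI allI impI; (elim conjE)?)
    (assumption | rule all_ones_non_maximizer projective_non_maximizer paley_biplane_non_maximizer)+

end
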